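(* Let $k\ge 5$ be an integer and let $\mathcal{N}\subset\mathbb{R}^2$ be the lattice polygon with vertices $(0,0)$, $(1,0)$, $(0,1)$, $(k+1,1)$ and $(1,2)$. Then there is no admissible (simple, oriented) dual hyperplane arrangement $\mathcal{H}\subset\mathbf{T}^2$ of $\mathcal{N}$.
   Context: $\mathbf{T}=\mathbb{R}/2\pi\mathbb{Z}$, with $\mathbf{T}^2$ having universal cover $\mathbb{R}^2$. Let $v_1,\dots,v_m$ be the vertices of a lattice polygon $\mathcal{N}$ in counterclockwise order (indices modulo $m$). The facet with endpoints $v_j,v_{j+1}$ is identified with the vector $\Gamma_j=v_{j+1}-v_j\in\mathbb{Z}^2$, and $\gamma_j=M\Gamma_j$, where $M$ is clockwise rotation by $\pi/2$. For the polygon of the claim the facets are, as vectors, $(-1,-1)$, $(0,-1)$, $(1,0)$, $(k,1)$ and $(-k,1)$. Dual arrangement: an oriented hyperplane arrangement in $\mathbf{T}^2$ is a finite union of oriented closed lines (images of oriented lines in $\mathbb{R}^2$ of rational slope). Group the lines into classes of lines that are parallel and equally oriented. The arrangement is dual to $\mathcal{N}$ if the classes $\mathcal{H}_j$ are in bijection with the facets of $\mathcal{N}$ in such a way that the total homology class of $\mathcal{H}_j$ in $H_1(\mathbf{T}^2)\simeq\mathbb{Z}^2$ is $\gamma_j$. For the polygon of the claim, a dual arrangement thus consists of five oriented lines, one with direction vector $\gamma_j$ for each facet $\Gamma_j$, with arbitrary positions. Simple: no three distinct lines of $\mathcal{H}$ have a common point. Admissible: view $\mathcal{H}$ as a polyhedral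 cell decomposition of $\mathbf{T}^2$ whose edges carry the orientations of the lines. A cell (two-dimensional region) is oriented if the orientations of all edges on its boundary form a consistently oriented (clockwise or counterclockwise) cycle. $\mathcal{H}$ is admissible if every edge lies on the boundary of at least one oriented cell. *)

theory Defs
  imports "HOL-Analysis.Analysis"
begin

quotient_type circle = real / "\<lambda>x y. \<exists>n::int. x - y = 2 * pi * of_int n"
  morphisms rep_circle abs_circle
proof (rule equivpI)
  show "reflp (\<lambda>x y. \<exists>n::int. x - y = 2 * pi * of_int n)"
    by (rule reflpI) (rule exI[of _ 0], simp)
  show "symp (\<lambda>x y. \<exists>n::int. x - y = 2 * pi * of_int n)"
  proof (rule sympI)
    fix x y :: real
    assume "\<exists>n::int. x - y = 2 * pi * of_int n"
    then obtain n :: int where "x - y = 2 * pi * of_int n" by blast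
    then have "y - x = 2 * pi * of_int (- n)" by (simp add: algebra_simps)
    then show "\<exists>n::int. y - x = 2 * pi * of_int n" by blast
  qed
  show "transp (\<lambda>x y. \<exists>n::int. x - y = 2 * pi * of_int n)"
  proof (rule transpI)
    fix x y z :: real
    assume "\<exists>n::int. x - y = 2 * pi * of_int n" "\<exists>n::int. y - z = 2 * pi * of_int n"
    then obtain n m :: int
      where "x - y = 2 * pi * of_int n" "y - z = 2 * pi * of_int m" by blast
    then have "x - z = 2 * pi * of_int (n + m)" by (simp add: algebra_simps)
    then show "\<exists>n::int. x - z = 2 * pi * of_int n" by blast
  qed
qed

instantiation circle :: topological_space
begin

definition open_circle :: "circle set \<Rightarrow> bool"
  where "open_circle U \<longleftrightarrow> open (abs_circle -` U)"

instance
proof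
  show "open (UNIV :: circle set)"
    by (simp add: open_circle_def)
  show "open (S \<inter> T)" if "open S" "open T" for S T :: "circle set"
    using that by (simp add: open_circle_def open_Int)
  show "open (\<Union> K)" if "\<forall>S\<in>K. open S" for K :: "circle set set"
    using that by (auto simp: open_circle_def vimage_Union)
qed

end

type_synonym torus = "circle \<times> circle"

definition torus_proj :: "real \<times> real \<Rightarrow> torus"
  where "torus_proj = map_prod abs_circle abs_circle"

definition lattice_vec :: "int \<times> int \<Rightarrow> real \<times> real"
  where "lattice_vec = map_prod of_int of_int"

definition cross :: "int \<times> int \<Rightarrow> int \<times> int \<Rightarrow> int"
  where "cross a b = fst a * snd b - snd a * fst b"

text \<open>The side vector from the \<open>j\<close>-th to the next vertex, indices modulo the number of vertices.\<close>

definition facet :: "(int \<times> int) list \<Rightarrow> nat \<Rightarrow> int \<times> int"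
  where "facet vs j = vs ! (Suc j mod length vs) - vs ! j"

text \<open>\<open>vs\<close> lists the vertices of the lattice polygon \<open>N\<close> counterclockwise: for each side, all the
  remaining vertices lie strictly to its left.\<close>

definition ccw_vertices :: "(real \<times> real) set \<Rightarrow> (int \<times> int) list \<Rightarrow> bool"
  where "ccw_vertices N vs \<longleftrightarrow>
    3 \<le> length vs \<and> distinct vs \<and>
    N = convex hull (lattice_vec ` set vs) \<and>
    {v. v extreme_point_of N} = lattice_vec ` set vs \<and>
    (\<forall>j<length vs. \<forall>i<length vs. i \<noteq> j \<longrightarrow> i \<noteq> Suc j mod length vs \<longrightarrow>
       0 < cross (facet vs j) (vs ! i - vs ! j))"

definition rot_cw :: "int \<times> int \<Rightarrow> int \<times> int"
  where "rot_cw a = (snd a, - fst a)"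

text \<open>An oriented closed line is its point set together with its primitive integral direction
  vector \<open>d\<close>.  Going once around the line lifts to a path from \<open>p\<close> to \<open>p + 2 * pi * d\<close>, so \<open>d\<close> is
  also the homology class of the line under the identification of the first homology group of the
  torus with the integer lattice.  Two lines are parallel and equally oriented iff their vectors
  agree.\<close>

type_synonym oriented_line = "torus set \<times> (int \<times> int)"

abbreviation (input) points :: "oriented_line \<Rightarrow> torus set" where "points \<equiv> fst"
abbreviation (input) dir :: "oriented_line \<Rightarrow> int \<times> int" where "dir \<equiv> snd"

definition is_oriented_line :: "oriented_line \<Rightarrow> bool"
  where "is_oriented_line L \<longleftrightarrow>
    coprime (fst (dir L)) (snd (dir L)) \<and>
    (\<exists>p. points L = torus_proj ` range (\<lambda>t::real. p + t *\<^sub>R lattice_vec (dir L)))"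

definition arrangement :: "oriented_line set \<Rightarrow> bool"
  where "arrangement H \<longleftrightarrow> finite H \<and> (\<forall>L\<in>H. is_oriented_line L)"

definition line_classes :: "oriented_line set \<Rightarrow> oriented_line set set"
  where "line_classes H = (\<lambda>d. {L \<in> H. dir L = d}) ` (dir ` H)"

definition dual_arrangement :: "(real \<times> real) set \<Rightarrow> oriented_line set \<Rightarrow> bool"
  where "dual_arrangement N H \<longleftrightarrow> arrangement H \<and>
    (\<exists>vs \<beta>. ccw_vertices N vs \<and> bij_betw \<beta> {..<length vs} (line_classes H) \<and>
       (\<forall>j<length vs. (\<Sum>L\<in>\<beta> j. dir L) = rot_cw (facet vs j)))"

definition simple_arrangement :: "oriented_line set \<Rightarrow> bool"
  where "simple_arrangement H \<longleftrightarrow>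
    (\<forall>L\<in>H. \<forall>L'\<in>H. \<forall>L''\<in>H. L \<noteq> L' \<longrightarrow> L \<noteq> L'' \<longrightarrow> L' \<noteq> L'' \<longrightarrow>
       points L \<inter> points L' \<inter> points L'' = {})"

definition arr_vertices :: "oriented_line set \<Rightarrow> torus set"
  where "arr_vertices H = {x. \<exists>L\<in>H. \<exists>L'\<in>H. L \<noteq> L' \<and> x \<in> points L \<and> x \<in> points L'}"

definition arr_edges :: "oriented_line set \<Rightarrow> torus set set"
  where "arr_edges H = components ((\<Union>L\<in>H. points L) - arr_vertices H)"

definition arr_cells :: "oriented_line set \<Rightarrow> torus set set"
  where "arr_cells H = components (- (\<Union>L\<in>H. points L))"

text \<open>The boundary cycle of a cell \<open>F\<close> is traversed on a lift \<open>P\<close> of \<open>F\<close> to the universal cover: on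
  the torus itself one edge may occur twice on the boundary of a cell, and distinct corners of a
  cell may coincide.  The list \<open>ps\<close> gives the corners of \<open>P\<close> in cyclic order (clockwise or
  counterclockwise), and every side must run along its edge in the direction of the line
  containing that edge.\<close>

definition oriented_cell :: "oriented_line set \<Rightarrow> torus set \<Rightarrow> bool"
  where "oriented_cell H F \<longleftrightarrow>
    (\<exists>P ps. P \<in> components (torus_proj -` F) \<and> distinct ps \<and>
       frontier P = (\<Union>i<length ps. closed_segment (ps ! i) (ps ! (Suc i mod length ps))) \<and>
       (\<forall>i<length ps. \<exists>L\<in>H. \<exists>c>0.
          torus_proj ` open_segment (ps ! i) (ps ! (Suc i mod length ps)) \<in> arr_edges H \<and>
          torus_proj ` open_segment (ps ! i) (ps ! (Suc i mod length ps)) \<subseteq> points L \<and>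
          ps ! (Suc i mod length ps) - ps ! i = c *\<^sub>R lattice_vec (dir L)))"

definition admissible :: "oriented_line set \<Rightarrow> bool"
  where "admissible H \<longleftrightarrow>
    (\<forall>e\<in>arr_edges H. \<exists>F\<in>arr_cells H. oriented_cell H F \<and> e \<subseteq> frontier F)"

end

(* A lift of a cell to the plane lies on one side of every lifted line.  If the cell is oriented, its
   boundary cycle reaches and leaves a line B along the lines crossing B at the two ends of an edge;
   staying on one side of B, these two lines must cross B with opposite signs.  So in an admissible
   arrangement the signs of consecutive crossings along a line alternate.

   On the line B of direction (1, -k) only the line C of direction (1, k) crosses with positive
   sign.  The crossings with C are equally spaced by pi / k, those with the lines of directions
   (-1, 0) and (-1, 1) by 2 pi / k and 2 pi / (k - 1).  Hence some gap between neighbouring crossings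
   with C contains a crossing with each of the latter two lines, against alternation. *)

theory Submission
  imports Defs
begin

section \<open>The universal cover of the torus\<close>

text \<open>An oriented cell is given only by segments that cover the frontier of one lift
  \<open>P\<close>; neither convexity nor boundedness of \<open>P\<close> nor the sense of rotation
  is part of the data. The argument therefore rests on a few features: sides run in the directions
  of their lines, each side is followed by one that starts at its end, no side has a vertex of the
  arrangement in its interior, and \<open>P\<close>, being connected and disjoint from all lifted
  lines, has its closure weakly on one side of each. Admissibility speaks of an edge on the torus,
  which must be found again on the frontier of this particular \<open>P\<close>. Two transversal
  lines bound \<open>P\<close>, and compactness of its closure then shows that this one lift already
  reaches every frontier point of the cell. Simplicity enters twice: at a vertex the cycle can go on
  only along \<open>B\<close> or along the one line crossing it there, and the crossings that are
  compared on \<open>B\<close> never coincide. The line of direction \<open>(0, -1)\<close> may lie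
  anywhere. It too crosses \<open>B\<close> with negative sign, so it cannot supply the positive
  crossing that alternation demands between two negative ones.\<close>

lemma abs_circle_eq_iff: "abs_circle x = abs_circle y \<longleftrightarrow> (\<exists>n::int. x - y = 2 * pi * of_int n)"
  by (fact circle.abs_eq_iff)

lemma torus_proj_eq_iff:
  "torus_proj u = torus_proj v \<longleftrightarrow> (\<exists>l. u - v = (2 * pi) *\<^sub>R lattice_vec l)"
  by (cases u; cases v) (auto simp: torus_proj_def lattice_vec_def abs_circle_eq_iff)

lemma torus_proj_translate [simp]: "torus_proj (u + (2 * pi) *\<^sub>R lattice_vec l) = torus_proj u"
  unfolding torus_proj_eq_iff by (metis add_diff_cancel_left')

lemma surj_torus_proj: "\<exists>u. torus_proj u = z"
proof -
  have "\<exists>x. abs_circle x = c" for c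
    by (metis Quotient_circle Quotient_abs_rep)
  then show ?thesis
    by (metis torus_proj_def map_prod_simp surj_pair)
qed

lemma continuous_abs_circle: "continuous_on UNIV abs_circle"
  by (simp add: continuous_on_open_vimage open_circle_def)

lemma continuous_torus_proj: "continuous_on A torus_proj"
proof -
  have "continuous_on UNIV (\<lambda>u. (abs_circle (fst u), abs_circle (snd u)))"
    by (intro continuous_on_Pair continuous_on_compose2[OF continuous_abs_circle] continuous_intros) auto
  moreover have "(\<lambda>u. (abs_circle (fst u), abs_circle (snd u))) = torus_proj"
    by (auto simp: torus_proj_def)
  ultimately show ?thesis
    by (metis continuous_on_subset subset_UNIV)
qed

lemma open_abs_circle_image:
  assumes "open U"
  shows "open (abs_circle ` U)"
proof -
  have "abs_circle -` abs_circle ` U = (\<Union>n::int. (+) (2 * pi * of_int n) ` U)"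
  proof (intro set_eqI iffI)
    fix x assume "x \<in> abs_circle -` abs_circle ` U"
    then obtain y where "y \<in> U" "abs_circle x = abs_circle y" by auto
    then obtain n :: int where "x - y = 2 * pi * of_int n" by (auto simp: abs_circle_eq_iff)
    then have "x = 2 * pi * of_int n + y" by simp
    with \<open>y \<in> U\<close> show "x \<in> (\<Union>n::int. (+) (2 * pi * of_int n) ` U)" by blast
  next
    fix x assume "x \<in> (\<Union>n::int. (+) (2 * pi * of_int n) ` U)"
    then obtain n :: int and y where "x = 2 * pi * of_int n + y" "y \<in> U" by auto
    moreover from this have "abs_circle x = abs_circle y" unfolding abs_circle_eq_iff by auto
    ultimately show "x \<in> abs_circle -` abs_circle ` U" by auto
  qed
  then show ?thesis
    using assms by (auto simp: open_circle_def intro!: open_translation)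
qed

lemma open_torus_proj_image:
  assumes "open U"
  shows "open (torus_proj ` U)"
  unfolding open_prod_def
proof
  fix z assume "z \<in> torus_proj ` U"
  then obtain u where u: "u \<in> U" "z = torus_proj u" by auto
  then obtain A B where "open A" "open B" "u \<in> A \<times> B" "A \<times> B \<subseteq> U"
    using assms open_prod_elim by metis
  moreover from this have "torus_proj ` (A \<times> B) = abs_circle ` A \<times> abs_circle ` B"
    by (auto simp: torus_proj_def)
  ultimately show "\<exists>A B. open A \<and> open B \<and> z \<in> A \<times> B \<and> A \<times> B \<subseteq> torus_proj ` U"
    using u by (metis image_eqI image_mono open_abs_circle_image)
qed

lemma closed_lattice: "closed (range (\<lambda>l. (2 * pi) *\<^sub>R lattice_vec l))"
proof -
  have "range lattice_vec = \<int> \<times> (\<int> :: real set)"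
    by (auto simp: lattice_vec_def Ints_def image_iff)
  then have "closed (range lattice_vec)"
    by (simp add: closed_Times)
  then have "closed ((*\<^sub>R) (2 * pi) ` range lattice_vec)"
    by (rule closed_scaling)
  then show ?thesis by (simp add: image_image)
qed

text \<open>The union of all lattice translates of \<open>K\<close> is closed, as the sum of a
  compact and a closed set. Its complement is open and saturated, and the projection is an open
  map.\<close>

lemma closed_torus_proj_image:
  assumes "compact K"
  shows "closed (torus_proj ` K)"
proof -
  let ?T = "\<Union>u\<in>K. \<Union>v\<in>range (\<lambda>l. (2 * pi) *\<^sub>R lattice_vec l). {u + v}"
  have "closed ?T"
    by (rule compact_closed_sums[OF assms closed_lattice])
  moreover have "- torus_proj ` K = torus_proj ` (- ?T)"
  proof (intro set_eqI iffI)
    fix z assume z: "z \<in> - torus_proj ` K"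
    obtain u where u: "torus_proj u = z" using surj_torus_proj by blast
    with z have "u \<notin> ?T" by auto
    with u show "z \<in> torus_proj ` (- ?T)" by blast
  next
    fix z assume "z \<in> torus_proj ` (- ?T)"
    then obtain u where u: "z = torus_proj u" "u \<notin> ?T" by auto
    have "z \<noteq> torus_proj v" if "v \<in> K" for v
    proof
      assume "z = torus_proj v"
      then obtain l where "u - v = (2 * pi) *\<^sub>R lattice_vec l" using u torus_proj_eq_iff by metis
      then have "u = v + (2 * pi) *\<^sub>R lattice_vec l" by (simp add: algebra_simps)
      with u that show False by blast
    qed
    then show "z \<in> - torus_proj ` K" by auto
  qed
  ultimately show ?thesis
    by (metis open_torus_proj_image closed_def double_complement open_Compl)
qed

section \<open>Cells of the torus and their lifts to the plane\<close>

lemma connected_torus_proj_image: "connected A \<Longrightarrow> connected (torus_proj ` A)"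
  by (intro connected_continuous_image continuous_torus_proj)

text \<open>The torus inherits local connectedness from the plane: a small ball around a lifted
  point projects to a connected set, which the component must swallow.\<close>

lemma open_vimage_component:
  assumes "open (torus_proj -` Y)" "F \<in> components Y"
  shows "open (torus_proj -` F)"
  unfolding open_contains_ball
proof
  fix u assume u: "u \<in> torus_proj -` F"
  then have "u \<in> torus_proj -` Y" using assms(2) in_components_subset by fastforce
  then obtain e where e: "e > 0" "ball u e \<subseteq> torus_proj -` Y"
    using assms(1) open_contains_ball by metis
  have "torus_proj ` ball u e \<subseteq> F"
  proof (rule components_maximal[OF assms(2)])
    show "connected (torus_proj ` ball u e)" by (simp add: connected_torus_proj_image)
    show "torus_proj ` ball u e \<subseteq> Y" using e by auto
    show "F \<inter> torus_proj ` ball u e \<noteq> {}" using u e by auto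
  qed
  then show "\<exists>e>0. ball u e \<subseteq> torus_proj -` F" using e by blast
qed

text \<open>A single bounded lift covers the whole cell. Within \<open>F\<close> the image of
  \<open>P\<close> is open, and it is also closed because there it agrees with the image of the
  compact set \<open>closure P\<close>; but \<open>F\<close> is connected.\<close>

lemma closure_component_lift:
  assumes Y: "open (torus_proj -` Y)" and F: "F \<in> components Y"
    and P: "P \<in> components (torus_proj -` F)" and bdd: "bounded P"
  shows "closure F \<subseteq> torus_proj ` closure P"
proof -
  have oF: "open (torus_proj -` F)" by (rule open_vimage_component[OF Y F])
  have PF: "P \<subseteq> torus_proj -` F" using P in_components_subset by blast
  have "open P" using open_components[OF oF P] .
  then have opP: "open (torus_proj ` P)" by (rule open_torus_proj_image)
  have clP: "closed (torus_proj ` closure P)"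
    using bdd by (intro closed_torus_proj_image) (simp add: compact_closure)
  have eq: "F \<inter> torus_proj ` closure P = F \<inter> torus_proj ` P"
  proof -
    \<comment> \<open>A component is relatively closed, so passing to \<open>closure P\<close> adds
      no point over \<open>F\<close>.\<close>
    have "u \<in> P" if "u \<in> closure P" "torus_proj u \<in> F" for u
    proof -
      have "closedin (top_of_set (torus_proj -` F)) P" using P by (rule closedin_component)
      then obtain T where T: "closed T" "P = torus_proj -` F \<inter> T" unfolding closedin_closed by blast
      then have "closure P \<subseteq> T" by (intro closure_minimal) auto
      then show ?thesis using that T by auto
    qed
    then show ?thesis using closure_subset[of P] by auto
  qed
  have "F \<subseteq> torus_proj ` P"
  proof (rule ccontr)
    assume "\<not> F \<subseteq> torus_proj ` P"
    then have "F \<inter> (- torus_proj ` closure P) \<noteq> {}" using eq by blast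
    moreover have "F \<inter> torus_proj ` P \<noteq> {}"
      using PF in_components_nonempty[OF P] by blast
    moreover have "connected F" using F in_components_connected by blast
    moreover have "open (- torus_proj ` closure P)" using clP by (simp add: open_Compl)
    moreover have "torus_proj ` P \<inter> - torus_proj ` closure P \<inter> F = {}"
      using closure_subset[of P] by blast
    moreover have "F \<subseteq> torus_proj ` P \<union> - torus_proj ` closure P"
      using eq by blast
    ultimately show False
      using opP connectedD[of F "torus_proj ` P" "- torus_proj ` closure P"] by (simp add: Int_commute)
  qed
  then have "F \<subseteq> torus_proj ` closure P" using closure_subset[of P] by blast
  then show ?thesis using clP by (rule closure_minimal)
qed

section \<open>Lifted lines\<close>

text \<open>The determinant of \<open>d\<close> and \<open>u\<close>, that is, \<open>cross\<close>
  with a real second argument. Its level sets are the lines of direction \<open>d\<close> and it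
  grows towards their left, so the sign of \<open>cross\<close> tells to which side a step
  leads.\<close>

definition level :: "int \<times> int \<Rightarrow> real \<times> real \<Rightarrow> real"
  where "level d u = of_int (fst d) * snd u - of_int (snd d) * fst u"

lemma level_add_lattice [simp]:
  "level d (u + c *\<^sub>R lattice_vec d') = level d u + c * of_int (cross d d')"
  by (simp add: level_def cross_def lattice_vec_def algebra_simps)

lemma cross_self [simp]: "cross d d = 0"
  by (simp add: cross_def)

lemma cross_commute: "cross a b = - cross b a"
  by (simp add: cross_def)

lemma continuous_level: "continuous_on A (level d)"
  unfolding level_def by (intro continuous_intros)

text \<open>A translation by \<open>2 * pi\<close> times a lattice vector \<open>l\<close> changes
  the level by \<open>2 * pi * cross d l\<close>, and for primitive \<open>d\<close> these numbers
  run through all multiples of \<open>2 * pi\<close>. This equal spacing of the lifts later yields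
  both the strips that confine a cell and the crossing times.\<close>

lemma line_levels:
  assumes "is_oriented_line L"
  shows "\<exists>c. \<forall>u. torus_proj u \<in> points L \<longleftrightarrow> (\<exists>n::int. level (dir L) u = c + 2 * pi * of_int n)"
proof -
  obtain d where d: "d = dir L" by blast
  from assms d obtain p where cop: "coprime (fst d) (snd d)"
    and pts: "points L = torus_proj ` range (\<lambda>t::real. p + t *\<^sub>R lattice_vec d)"
    by (auto simp: is_oriented_line_def)
  have "torus_proj u \<in> points L \<longleftrightarrow> (\<exists>n::int. level d u = level d p + 2 * pi * of_int n)" for u
  proof
    assume "torus_proj u \<in> points L"
    then obtain t where "torus_proj u = torus_proj (p + t *\<^sub>R lattice_vec d)" using pts by auto
    then obtain l where "u - (p + t *\<^sub>R lattice_vec d) = (2 * pi) *\<^sub>R lattice_vec l"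
      unfolding torus_proj_eq_iff by blast
    then have "u = (p + t *\<^sub>R lattice_vec d) + (2 * pi) *\<^sub>R lattice_vec l" by (simp add: algebra_simps)
    then have "level d u = level d p + 2 * pi * of_int (cross d l)"
      by (simp only: level_add_lattice) simp
    then show "\<exists>n::int. level d u = level d p + 2 * pi * of_int n" by blast
  next
    assume "\<exists>n::int. level d u = level d p + 2 * pi * of_int n"
    then obtain n :: int where n: "level d u = level d p + 2 * pi * of_int n" by blast
    obtain r s where rs: "r * fst d + s * snd d = 1"
      using cop bezout_int[of "fst d" "snd d"] by (auto simp: coprime_iff_gcd_eq_1)
    \<comment> \<open>Bezout gives a lattice vector whose \<open>cross\<close> with \<open>d\<close>
      is \<open>- n\<close>; translating by \<open>2 * pi\<close> times it brings \<open>u\<close>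
      to the level of \<open>p\<close>.\<close>
    define v where "v = u + (2 * pi) *\<^sub>R lattice_vec (n * s, - n * r)"
    have "cross d (n * s, - n * r) = - n"
    proof -
      have "cross d (n * s, - n * r) = - n * (r * fst d + s * snd d)"
        by (simp add: cross_def algebra_simps)
      then show ?thesis using rs by simp
    qed
    then have lv: "level d v = level d p" using n by (simp add: v_def)
    \<comment> \<open>The functional with coefficients \<open>r\<close> and \<open>s\<close> has the
      value 1 on \<open>d\<close>, so it reads off the parameter of \<open>v\<close> along the
      line.\<close>
    define t where "t = of_int r * (fst v - fst p) + of_int s * (snd v - snd p)"
    have rs': "of_int r * of_int (fst d) + of_int s * of_int (snd d) = (1::real)"
      using rs by (metis of_int_1 of_int_add of_int_mult)
    have e: "of_int (fst d) * (snd v - snd p) = of_int (snd d) * (fst v - fst p)"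
      using lv by (simp add: level_def algebra_simps)
    have "t * of_int (fst d) = of_int r * of_int (fst d) * (fst v - fst p) + of_int s * (of_int (fst d) * (snd v - snd p))"
      by (simp add: t_def algebra_simps)
    also have "\<dots> = (of_int r * of_int (fst d) + of_int s * of_int (snd d)) * (fst v - fst p)"
      unfolding e by (simp add: algebra_simps)
    finally have 1: "t * of_int (fst d) = fst v - fst p" by (simp only: rs' mult_1)
    have "t * of_int (snd d) = of_int r * (of_int (snd d) * (fst v - fst p)) + of_int s * of_int (snd d) * (snd v - snd p)"
      by (simp add: t_def algebra_simps)
    also have "\<dots> = (of_int r * of_int (fst d) + of_int s * of_int (snd d)) * (snd v - snd p)"
      unfolding e[symmetric] by (simp add: algebra_simps)
    finally have 2: "t * of_int (snd d) = snd v - snd p" by (simp only: rs' mult_1)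
    have "v = p + t *\<^sub>R lattice_vec d"
      using 1 2 by (auto simp: prod_eq_iff lattice_vec_def)
    moreover have "torus_proj u = torus_proj v" by (simp add: v_def)
    ultimately show "torus_proj u \<in> points L" using pts by auto
  qed
  with d show ?thesis by blast
qed

lemma same_level_in_line:
  assumes "is_oriented_line L" "torus_proj u \<in> points L" "level (dir L) v = level (dir L) u"
  shows "torus_proj v \<in> points L"
  by (metis assms line_levels)

lemma closed_vimage_line:
  assumes "is_oriented_line L"
  shows "closed (torus_proj -` points L)"
proof -
  obtain c where c: "\<And>u. torus_proj u \<in> points L \<longleftrightarrow> (\<exists>n::int. level (dir L) u = c + 2 * pi * of_int n)"
    using line_levels[OF assms] by blast
  have "torus_proj -` points L = (\<lambda>u. (level (dir L) u - c) / (2 * pi)) -` \<int>"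
  proof (rule set_eqI)
    fix u
    have "level (dir L) u = c + 2 * pi * of_int n \<longleftrightarrow> (level (dir L) u - c) / (2 * pi) = of_int n" for n :: int
      by (auto simp: field_simps)
    then show "u \<in> torus_proj -` points L \<longleftrightarrow> u \<in> (\<lambda>u. (level (dir L) u - c) / (2 * pi)) -` \<int>"
      unfolding vimage_eq c Ints_def by auto
  qed
  moreover have "closed \<dots>"
    by (intro closed_vimage closed_Ints continuous_intros continuous_level) simp
  ultimately show ?thesis by simp
qed

lemma closed_segment_in_line:
  assumes "is_oriented_line L" "torus_proj ` open_segment u v \<subseteq> points L" "u \<noteq> v"
    and "w \<in> closed_segment u v"
  shows "torus_proj w \<in> points L"
proof -
  have "closure (open_segment u v) \<subseteq> torus_proj -` points L"
    using assms by (intro closure_minimal closed_vimage_line) auto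
  then show ?thesis using assms by auto
qed

text \<open>Intermediate values of the level on \<open>P\<close>. The compared points lie only in
  the closure, because corners of a cell lie on its frontier; hence a weak inequality in the
  conclusion.\<close>

lemma connected_avoids_level:
  assumes "connected P" and "\<And>w. w \<in> P \<Longrightarrow> level d w \<noteq> a"
    and "u \<in> closure P" "v \<in> closure P" "level d u < a"
  shows "level d v \<le> a"
proof (rule ccontr)
  assume "\<not> level d v \<le> a"
  have o: "open {w. level d w < a}" "open {w. a < level d w}"
    by (intro open_Collect_less continuous_level continuous_intros)+
  obtain u' where u': "u' \<in> P" "level d u' < a"
    using assms(3,5) o(1) open_Int_closure_eq_empty[OF o(1), of P] by blast
  obtain v' where v': "v' \<in> P" "a < level d v'"
    using assms(4) \<open>\<not> _\<close> open_Int_closure_eq_empty[OF o(2), of P] by force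
  have "connected (level d ` P)"
    using assms(1) by (intro connected_continuous_image continuous_level)
  then have "a \<in> level d ` P"
    using u' v' connectedD_interval[of "level d ` P" "level d u'" "level d v'" a] by auto
  then show False using assms(2) by auto
qed

text \<open>Off the line, \<open>P\<close> is trapped in the strip between two neighbouring lifts of
  \<open>L\<close>. Two such strips in independent directions confine a cell.\<close>

lemma level_bounded_off_line:
  assumes L: "is_oriented_line L" and P: "connected P" "\<And>w. w \<in> P \<Longrightarrow> torus_proj w \<notin> points L"
  obtains r where "\<And>w. w \<in> P \<Longrightarrow> \<bar>level (dir L) w\<bar> \<le> r"
proof (cases "P = {}")
  case True
  then show thesis using that[of 0] by simp
next
  case False
  then obtain u where u: "u \<in> P" by blast
  obtain c where c: "\<And>u. torus_proj u \<in> points L \<longleftrightarrow> (\<exists>n::int. level (dir L) u = c + 2 * pi * of_int n)"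
    using line_levels[OF L] by blast
  obtain q where q: "q = (level (dir L) u - c) / (2 * pi)" by blast
  obtain n :: int where n: "of_int n \<le> q" "q < of_int (n + 1)"
    using floor_correct by blast
  let ?a = "c + 2 * pi * of_int n" and ?b = "c + 2 * pi * of_int (n + 1)"
  have "level (dir L) u = c + 2 * pi * q" using q by simp
  moreover have "2 * pi * of_int n \<le> 2 * pi * q" "2 * pi * q < 2 * pi * of_int (n + 1)"
    using n by (auto intro: mult_left_mono mult_strict_left_mono)
  ultimately have ab: "?a \<le> level (dir L) u" "level (dir L) u < ?b"
    by linarith+
  have off: "level (dir L) w \<noteq> c + 2 * pi * of_int n" if "w \<in> P" for w n
    using P(2)[OF that] c by blast
  have "?a \<le> level (dir L) w \<and> level (dir L) w \<le> ?b" if w: "w \<in> P" for w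
  proof
    show "level (dir L) w \<le> ?b"
      using connected_avoids_level[OF P(1) off _ _ ab(2)] u w closure_subset by blast
    have "?a < level (dir L) u" using ab(1) off[OF u, of n] by linarith
    then show "?a \<le> level (dir L) w"
      using connected_avoids_level[OF P(1) off, of w u n] u w closure_subset by fastforce
  qed
  then have "\<bar>level (dir L) w\<bar> \<le> \<bar>?a\<bar> + \<bar>?b\<bar>" if "w \<in> P" for w using that by fastforce
  then show thesis using that by blast
qed

lemma bounded_of_levels:
  assumes "cross d d' \<noteq> 0" and "\<And>w. w \<in> P \<Longrightarrow> \<bar>level d w\<bar> \<le> r" "\<And>w. w \<in> P \<Longrightarrow> \<bar>level d' w\<bar> \<le> r'"
  shows "bounded P"
proof -
  let ?c = "real_of_int (cross d d')"
  \<comment> \<open>Cramer's rule: the inverse of the linear map that sends a point to its two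
    levels.\<close>
  let ?f = "\<lambda>x. ((of_int (fst d') * fst x - of_int (fst d) * snd x) / ?c,
                 (of_int (snd d') * fst x - of_int (snd d) * snd x) / ?c)"
  have "compact (?f ` ({- r..r} \<times> {- r'..r'}))"
    using assms(1) by (intro compact_continuous_image continuous_intros compact_Times) auto
  moreover have "P \<subseteq> ?f ` ({- r..r} \<times> {- r'..r'})"
  proof
    fix w assume "w \<in> P"
    then have "(level d w, level d' w) \<in> {- r..r} \<times> {- r'..r'}"
      using assms(2,3)[of w] by auto
    moreover have "w = ?f (level d w, level d' w)"
    proof -
      have "?c \<noteq> 0" using assms(1) by simp
      moreover have "fst w * ?c = of_int (fst d') * level d w - of_int (fst d) * level d' w"
        "snd w * ?c = of_int (snd d') * level d w - of_int (snd d) * level d' w"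
        by (simp_all add: level_def cross_def algebra_simps)
      ultimately show ?thesis by (simp add: prod_eq_iff nonzero_eq_divide_eq)
    qed
    ultimately show "w \<in> ?f ` ({- r..r} \<times> {- r'..r'})" by (rule rev_image_eqI)
  qed
  ultimately show ?thesis using compact_imp_bounded bounded_subset by blast
qed


section \<open>Consecutive crossings\<close>

text \<open>\<open>S\<close> is the set of sides of a boundary cycle; \<open>\<sigma> = - 1\<close> is for the reversed cycle, whose sides
  run against the lines.\<close>

lemma boundary_turns:
  fixes \<sigma> :: real and S :: "((real \<times> real) \<times> (real \<times> real)) set"
  assumes lines: "\<And>L. L \<in> H \<Longrightarrow> is_oriented_line L" and simple: "simple_arrangement H"
    and \<sigma>: "\<sigma> \<noteq> 0" and S: "finite S" and nxt: "\<And>u v. (u, v) \<in> S \<Longrightarrow> \<exists>w. (v, w) \<in> S"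
    and side: "\<And>u v. (u, v) \<in> S \<Longrightarrow> \<exists>L\<in>H. \<exists>c>0. v = u + (\<sigma> * c) *\<^sub>R lattice_vec (dir L) \<and>
      (\<forall>w\<in>closed_segment u v. torus_proj w \<in> points L) \<and>
      (\<forall>w\<in>open_segment u v. torus_proj w \<notin> arr_vertices H)"
    and B: "B \<in> H" and W: "W \<in> H" "W \<noteq> B" and cr: "cross (dir W) (dir B) \<noteq> 0"
    and y: "torus_proj y \<in> points B" "torus_proj y \<in> points W"
    and start: "(u0, v0) \<in> S" "y + (- (\<sigma> * r)) *\<^sub>R lattice_vec (dir B) \<in> closed_segment u0 v0" "r > 0"
    and free: "\<And>t. 0 < t \<Longrightarrow> t \<le> r \<Longrightarrow>
      torus_proj (y + (- (\<sigma> * t)) *\<^sub>R lattice_vec (dir B)) \<notin> arr_vertices H"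
    and K: "\<And>u v. (u, v) \<in> S \<Longrightarrow> u \<in> K"
    and sep: "\<And>u v. u \<in> K \<Longrightarrow> v \<in> K \<Longrightarrow> level (dir W) u < level (dir W) y \<Longrightarrow>
      level (dir W) v \<le> level (dir W) y"
  shows "\<exists>w\<in>K. \<exists>c>0. w = y + (\<sigma> * c) *\<^sub>R lattice_vec (dir W)"
proof -
  \<comment> \<open>The point of \<open>B\<close> from which a parameter distance \<open>t\<close>
    remains to \<open>y\<close>. Sides on \<open>B\<close> advance by positive multiples of
    \<open>\<sigma>\<close> and so decrease \<open>t\<close>, in either sense of traversal.\<close>
  define pos where "pos t = y + (- (\<sigma> * t)) *\<^sub>R lattice_vec (dir B)" for t
  have pos0 [simp]: "pos 0 = y" by (simp add: pos_def)
  have "lattice_vec (dir B) \<noteq> 0"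
    using cr by (auto simp: lattice_vec_def cross_def prod_eq_iff)
  then have inj: "inj pos" using \<sigma> by (auto simp: inj_def pos_def)
  have pos_shift: "pos t + (\<sigma> * c) *\<^sub>R lattice_vec (dir B) = pos (t - c)" for t c
    by (simp add: pos_def algebra_simps flip: scaleR_add_left)
  have pos_B: "torus_proj (pos t) \<in> points B" for t
    unfolding pos_def
    by (rule same_level_in_line[OF lines[OF B] y(1)], unfold level_add_lattice, simp)
  have y_vertex: "torus_proj y \<in> arr_vertices H"
    using B W y unfolding arr_vertices_def by blast
  have unique: "L = B" if "L \<in> H" "torus_proj (pos t) \<in> points L" "0 < t" "t \<le> r" for L t
    using free[OF that(3,4)] that(1,2) B pos_B unfolding pos_def[symmetric] arr_vertices_def by blast
  \<comment> \<open>A side on \<open>B\<close> that starts before \<open>y\<close> cannot run past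
    it, since \<open>y\<close> is a vertex and the interior of a side contains none.\<close>
  have stop: "0 \<le> \<beta>" if "0 < \<alpha>" "\<beta> < \<alpha>"
    "\<forall>w\<in>open_segment (pos \<alpha>) (pos \<beta>). torus_proj w \<notin> arr_vertices H" for \<alpha> \<beta>
  proof (rule ccontr)
    assume "\<not> 0 \<le> \<beta>"
    define s where "s = \<alpha> / (\<alpha> - \<beta>)"
    have s: "0 < s" "s < 1" using that \<open>\<not> 0 \<le> \<beta>\<close> by (auto simp: s_def field_simps)
    have "(1 - s) * \<alpha> + s * \<beta> = 0" using that by (simp add: s_def field_simps)
    then have "\<sigma> * ((1 - s) * \<alpha> + s * \<beta>) = 0" by simp
    moreover have "(1 - s) *\<^sub>R pos \<alpha> + s *\<^sub>R pos \<beta> = y - (\<sigma> * ((1 - s) * \<alpha> + s * \<beta>)) *\<^sub>R lattice_vec (dir B)"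
      by (simp add: pos_def algebra_simps)
    ultimately have "y = (1 - s) *\<^sub>R pos \<alpha> + s *\<^sub>R pos \<beta>" by simp
    moreover have "pos \<alpha> \<noteq> pos \<beta>" using inj that(2) by (auto simp: inj_def)
    ultimately have "y \<in> open_segment (pos \<alpha>) (pos \<beta>)"
      using s unfolding in_segment by blast
    then show False using that(3) y_vertex by blast
  qed
  \<comment> \<open>The parameters at which sides on \<open>B\<close> heading for \<open>y\<close>
    end. The side through \<open>pos r\<close> contributes one, and the least one belongs to the
    corner on \<open>B\<close> closest to \<open>y\<close>.\<close>
  define T where "T = {\<beta>. 0 \<le> \<beta> \<and> \<beta> \<le> r \<and> (\<exists>\<alpha>>\<beta>. (pos \<alpha>, pos \<beta>) \<in> S)}"
  have "T \<subseteq> pos -` (snd ` S)" unfolding T_def by force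
  then have finT: "finite T"
    using S inj by (meson finite_imageI finite_vimageI finite_subset)
  have "T \<noteq> {}"
  proof -
    obtain L c where L: "L \<in> H" "c > 0" "v0 = u0 + (\<sigma> * c) *\<^sub>R lattice_vec (dir L)"
      "\<forall>w\<in>closed_segment u0 v0. torus_proj w \<in> points L"
      "\<forall>w\<in>open_segment u0 v0. torus_proj w \<notin> arr_vertices H"
      using side[OF start(1)] by blast
    have "pos r \<in> closed_segment u0 v0" using start(2) by (simp add: pos_def)
    moreover from this have "L = B" using unique[of L r] L start(3) by blast
    ultimately obtain s where s: "0 \<le> s" "s \<le> 1" "pos r = (1 - s) *\<^sub>R u0 + s *\<^sub>R v0"
      unfolding in_segment by blast
    have "pos r = u0 + (\<sigma> * (s * c)) *\<^sub>R lattice_vec (dir B)"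
      unfolding s(3) L(3) \<open>L = B\<close> by (simp add: algebra_simps)
    then have "u0 = pos r + (\<sigma> * (- (s * c))) *\<^sub>R lattice_vec (dir B)" by simp
    then have u0: "u0 = pos (r + s * c)" unfolding pos_shift by simp
    then have "v0 = pos (r + s * c) + (\<sigma> * c) *\<^sub>R lattice_vec (dir B)" using L(3) \<open>L = B\<close> by simp
    then have v0: "v0 = pos (r + s * c - c)" unfolding pos_shift .
    have "s * c \<ge> 0" using s L(2) by simp
    moreover have "s * c \<le> c" using s(2) L(2) mult_right_mono[of s 1 c] by simp
    ultimately have "r + s * c - c \<in> T"
      using stop[of "r + s * c" "r + s * c - c"] start(1,3) L(2,5) unfolding u0 v0 T_def by force
    then show ?thesis by blast
  qed
  define \<beta> where "\<beta> = Min T"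
  have "\<beta> \<in> T" using finT \<open>T \<noteq> {}\<close> by (simp add: \<beta>_def)
  then obtain \<alpha> where \<beta>: "0 \<le> \<beta>" "\<beta> \<le> r" "\<alpha> > \<beta>" "(pos \<alpha>, pos \<beta>) \<in> S" unfolding T_def by blast
  obtain w where w: "(pos \<beta>, w) \<in> S" using nxt \<beta>(4) by blast
  obtain L c where L: "L \<in> H" "c > 0" "w = pos \<beta> + (\<sigma> * c) *\<^sub>R lattice_vec (dir L)"
    "\<forall>w\<in>closed_segment (pos \<beta>) w. torus_proj w \<in> points L"
    "\<forall>w\<in>open_segment (pos \<beta>) w. torus_proj w \<notin> arr_vertices H"
    using side[OF w] by blast
  have pL: "torus_proj (pos \<beta>) \<in> points L" using L(4) by simp
  have wK: "w \<in> K" using nxt[OF w] K by blast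
  \<comment> \<open>Before \<open>y\<close> no line other than \<open>B\<close> passes through the
    corner, so the next side would lie on \<open>B\<close> again and end at a smaller element of
    \<open>T\<close>.\<close>
  have "\<beta> = 0"
  proof (rule ccontr)
    assume "\<beta> \<noteq> 0"
    then have "\<beta> > 0" using \<beta> by simp
    then have "L = B" using unique[OF L(1) pL] \<beta> by simp
    then have w': "w = pos (\<beta> - c)" using L(3) pos_shift by simp
    then have "0 \<le> \<beta> - c" using stop[of \<beta> "\<beta> - c"] L(2,5) \<open>\<beta> > 0\<close> by simp
    then have "\<beta> - c \<in> T" using w \<beta> L(2) unfolding w' T_def by force
    then have "\<beta> \<le> \<beta> - c" using finT by (simp add: \<beta>_def)
    then show False using L(2) by simp
  qed
  then have "L = B \<or> L = W"
    using pL L(1) B W y simple unfolding simple_arrangement_def by auto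
  \<comment> \<open>Going straight on would put corners strictly on both sides of \<open>W\<close>,
    against \<open>sep\<close>.\<close>
  moreover have "L \<noteq> B"
  proof
    assume "L = B"
    define \<kappa> where "\<kappa> = \<sigma> * of_int (cross (dir W) (dir B))"
    have "\<kappa> \<noteq> 0" using \<sigma> cr by (simp add: \<kappa>_def)
    have "level (dir W) w = level (dir W) y + c * \<kappa>"
      using L(3) \<open>L = B\<close> \<open>\<beta> = 0\<close> by (simp add: \<kappa>_def)
    moreover have "level (dir W) (pos \<alpha>) = level (dir W) y - \<alpha> * \<kappa>"
      unfolding pos_def level_add_lattice by (simp add: \<kappa>_def)
    moreover have "pos \<alpha> \<in> K" using K \<beta> by blast
    moreover have "c * \<kappa> > 0 \<and> \<alpha> * \<kappa> > 0 \<or> c * \<kappa> < 0 \<and> \<alpha> * \<kappa> < 0"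
      using \<open>\<kappa> \<noteq> 0\<close> L(2) \<beta>(1,3) by (auto simp: zero_less_mult_iff mult_less_0_iff)
    ultimately show False
      using sep[of w "pos \<alpha>"] sep[of "pos \<alpha>" w] wK by auto
  qed
  ultimately show ?thesis using L(2,3) \<open>\<beta> = 0\<close> wK by auto
qed

text \<open>Followed forwards, the boundary cycle of an oriented cell at this edge leaves the far
  end along \<open>W'\<close>; followed backwards, it leaves the near end against \<open>W\<close>.
  Measured from \<open>B\<close>, the two points reached have levels with the signs of
  \<open>cross (dir B) (dir W')\<close> and \<open>- cross (dir B) (dir W)\<close>, and the cell
  lies on one side of \<open>B\<close>.\<close>

lemma crossings_alternate:
  assumes arr: "arrangement H" and simple: "simple_arrangement H" and adm: "admissible H"
    and B: "B \<in> H" and W: "W \<in> H" "W \<noteq> B" and W': "W' \<in> H" "W' \<noteq> B"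
    and cr: "cross (dir B) (dir W) \<noteq> 0" and cr': "cross (dir B) (dir W') \<noteq> 0"
    and x: "torus_proj x \<in> points B" "torus_proj x \<in> points W"
    and y: "torus_proj (x + s *\<^sub>R lattice_vec (dir B)) \<in> points W'" and s: "s > 0"
    and free: "\<And>t. 0 < t \<Longrightarrow> t < s \<Longrightarrow> torus_proj (x + t *\<^sub>R lattice_vec (dir B)) \<notin> arr_vertices H"
  shows "cross (dir B) (dir W) * cross (dir B) (dir W') < 0"
proof -
  let ?b = "lattice_vec (dir B)"
  define X where "X = (\<Union>L\<in>H. points L)"
  have lines: "is_oriented_line L" if "L \<in> H" for L using arr that by (simp add: arrangement_def)
  have "finite H" using arr by (simp add: arrangement_def)
  have on_B: "torus_proj (x + t *\<^sub>R ?b) \<in> points B" for t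
    using same_level_in_line[OF lines[OF B] x(1)] by simp
  define z where "z = x + (s / 2) *\<^sub>R ?b"
  have z: "torus_proj z \<in> X - arr_vertices H"
    using on_B B free[of "s / 2"] s by (auto simp: z_def X_def)
  define e where "e = connected_component_set (X - arr_vertices H) (torus_proj z)"
  have "e \<in> arr_edges H"
    using z unfolding e_def arr_edges_def X_def components_def by blast
  then obtain F where F: "F \<in> arr_cells H" "oriented_cell H F" "e \<subseteq> frontier F"
    using adm unfolding admissible_def by blast
  have "torus_proj z \<in> e" using z by (simp add: e_def)
  then have zF: "torus_proj z \<in> closure F" using F(3) by (auto simp: frontier_def)
  obtain P ps where P: "P \<in> components (torus_proj -` F)"
    and frP: "frontier P = (\<Union>i<length ps. closed_segment (ps ! i) (ps ! (Suc i mod length ps)))"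
    and sides: "\<forall>i<length ps. \<exists>L\<in>H. \<exists>c>0.
          torus_proj ` open_segment (ps ! i) (ps ! (Suc i mod length ps)) \<in> arr_edges H \<and>
          torus_proj ` open_segment (ps ! i) (ps ! (Suc i mod length ps)) \<subseteq> points L \<and>
          ps ! (Suc i mod length ps) - ps ! i = c *\<^sub>R lattice_vec (dir L)"
    using F(2) unfolding oriented_cell_def by blast
  have Fc: "F \<in> components (- X)" using F(1) by (simp add: arr_cells_def X_def)
  have "connected P" using P in_components_connected by blast
  have PX: "torus_proj w \<notin> X" if "w \<in> P" for w
    using that in_components_subset[OF P] in_components_subset[OF Fc] by auto
  then have Poff: "torus_proj w \<notin> points L" if "w \<in> P" "L \<in> H" for w L
    using that by (auto simp: X_def)
  have sep: "level (dir L) v \<le> level (dir L) a"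
    if "L \<in> H" "torus_proj a \<in> points L" "u \<in> closure P" "v \<in> closure P"
      "level (dir L) u < level (dir L) a" for L a u v
  proof (rule connected_avoids_level[OF \<open>connected P\<close> _ that(3-5)])
    show "level (dir L) w \<noteq> level (dir L) a" if "w \<in> P" for w
      using Poff[OF that \<open>L \<in> H\<close>] same_level_in_line[OF lines \<open>torus_proj a \<in> points L\<close>] \<open>L \<in> H\<close> by blast
  qed
  have "bounded P"
  proof -
    obtain r where "\<And>w. w \<in> P \<Longrightarrow> \<bar>level (dir B) w\<bar> \<le> r"
      using level_bounded_off_line[OF lines[OF B] \<open>connected P\<close>] Poff B by blast
    moreover obtain r' where "\<And>w. w \<in> P \<Longrightarrow> \<bar>level (dir W) w\<bar> \<le> r'"
      using level_bounded_off_line[OF lines[OF W(1)] \<open>connected P\<close>] Poff W by blast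
    ultimately show ?thesis using bounded_of_levels[OF cr] by blast
  qed
  moreover have "open (torus_proj -` (- X))"
  proof -
    have "closed (\<Union>L\<in>H. torus_proj -` points L)"
      using \<open>finite H\<close> lines by (intro closed_UN ballI closed_vimage_line) auto
    moreover have "torus_proj -` (- X) = - (\<Union>L\<in>H. torus_proj -` points L)" unfolding X_def by blast
    ultimately show ?thesis by (simp only: open_Compl)
  qed
  ultimately obtain z' where z': "z' \<in> closure P" "torus_proj z' = torus_proj z"
    using closure_component_lift[OF _ Fc P] zF by (metis imageE subsetD)
  have "z' \<notin> P" using PX[of z'] z'(2) z by (metis DiffD1)
  then have "z' \<in> frontier P"
    using z'(1) interior_subset by (auto simp: frontier_def)
  obtain l where "z' - z = (2 * pi) *\<^sub>R lattice_vec l" using z'(2) torus_proj_eq_iff by metis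
  \<comment> \<open>The edge is shifted by the lattice translation that takes its midpoint to the
    frontier of the lift chosen by the orientation condition.\<close>
  define x' where "x' = x + (2 * pi) *\<^sub>R lattice_vec l"
  have z'x: "z' = x' + (s / 2) *\<^sub>R ?b"
    using \<open>z' - z = _\<close> by (simp add: x'_def z_def algebra_simps)
  have proj_x': "torus_proj (x' + t *\<^sub>R ?b) = torus_proj (x + t *\<^sub>R ?b)" for t
  proof -
    have "x' + t *\<^sub>R ?b = (x + t *\<^sub>R ?b) + (2 * pi) *\<^sub>R lattice_vec l" by (simp add: x'_def)
    then show ?thesis by (simp only: torus_proj_translate)
  qed
  define y' where "y' = x' + s *\<^sub>R ?b"
  have x'B: "torus_proj x' \<in> points B" and x'W: "torus_proj x' \<in> points W"
    using x by (simp_all add: x'_def)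
  have y'B: "torus_proj y' \<in> points B" and y'W: "torus_proj y' \<in> points W'"
    using y on_B by (simp_all add: y'_def proj_x')
  define S where "S = (\<lambda>i. (ps ! i, ps ! (Suc i mod length ps))) ` {..<length ps}"
  have "finite S" by (simp add: S_def)
  have nxt: "\<exists>w. (v, w) \<in> S" if "(u, v) \<in> S" for u v
  proof -
    obtain i where i: "i < length ps" "v = ps ! (Suc i mod length ps)" using \<open>(u, v) \<in> S\<close> by (auto simp: S_def)
    then have "Suc i mod length ps < length ps" by (intro mod_less_divisor) linarith
    with i(2) show ?thesis unfolding S_def by blast
  qed
  have prv: "\<exists>w. (w, u) \<in> S" if "(u, v) \<in> S" for u v
  proof -
    obtain i where i: "i < length ps" "u = ps ! i" using \<open>(u, v) \<in> S\<close> by (auto simp: S_def)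
    have "\<exists>j<length ps. Suc j mod length ps = i"
    proof (cases i)
      case 0
      then show ?thesis using i(1) by (intro exI[of _ "length ps - 1"]) auto
    next
      case (Suc j)
      then show ?thesis using i(1) by (intro exI[of _ j]) auto
    qed
    with i(2) show ?thesis unfolding S_def by blast
  qed
  have SK: "u \<in> closure P" "v \<in> closure P" if uv: "(u, v) \<in> S" for u v
  proof -
    obtain i where "i < length ps" "u = ps ! i" "v = ps ! (Suc i mod length ps)"
      using uv by (auto simp: S_def)
    then have "closed_segment u v \<subseteq> frontier P" unfolding frP by blast
    then have "closed_segment u v \<subseteq> closure P" by (auto simp: frontier_def)
    then show "u \<in> closure P" "v \<in> closure P" by auto
  qed
  have side: "\<exists>L\<in>H. \<exists>c>0. v = u + c *\<^sub>R lattice_vec (dir L) \<and>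
      (\<forall>w\<in>closed_segment u v. torus_proj w \<in> points L) \<and>
      (\<forall>w\<in>open_segment u v. torus_proj w \<notin> arr_vertices H)" if uv: "(u, v) \<in> S" for u v
  proof -
    obtain i where "i < length ps" "u = ps ! i" "v = ps ! (Suc i mod length ps)"
      using uv by (auto simp: S_def)
    then obtain L c where L: "L \<in> H" "c > 0" "torus_proj ` open_segment u v \<in> arr_edges H"
      "torus_proj ` open_segment u v \<subseteq> points L" "v - u = c *\<^sub>R lattice_vec (dir L)"
      using sides by blast
    have "lattice_vec (dir L) \<noteq> 0"
      using lines[OF L(1)] by (auto simp: is_oriented_line_def lattice_vec_def prod_eq_iff)
    then have "u \<noteq> v" using L(2,5) by auto
    have "torus_proj ` open_segment u v \<subseteq> X - arr_vertices H"
      using L(3) in_components_subset unfolding arr_edges_def X_def by blast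
    moreover have "v = u + c *\<^sub>R lattice_vec (dir L)" using L(5) by (simp add: algebra_simps)
    ultimately show ?thesis
      using L(1,2) closed_segment_in_line[OF lines[OF L(1)] L(4) \<open>u \<noteq> v\<close>] by blast
  qed
  obtain u0 v0 where uv0: "(u0, v0) \<in> S" "z' \<in> closed_segment u0 v0"
    using \<open>z' \<in> frontier P\<close> unfolding frP S_def by blast
  \<comment> \<open>The walk starts on the side through the midpoint \<open>z'\<close>, so a
    parameter distance \<open>s / 2\<close> remains to the end of the edge.\<close>
  have "\<exists>w\<in>closure P. \<exists>c>0. w = y' + (1 * c) *\<^sub>R lattice_vec (dir W')"
  proof (rule boundary_turns[where \<sigma> = 1 and r = "s / 2", OF lines simple _ \<open>finite S\<close> nxt _ B W' _ y'B y'W uv0(1)])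
    show "cross (dir W') (dir B) \<noteq> 0" using cr' by (simp add: cross_def algebra_simps)
    have "y' + - (1 * (s / 2)) *\<^sub>R ?b = x' + (s - s / 2) *\<^sub>R ?b"
      unfolding y'_def by (simp only: scaleR_left_diff_distrib) (simp add: algebra_simps)
    then show "y' + - (1 * (s / 2)) *\<^sub>R ?b \<in> closed_segment u0 v0"
      using uv0(2) by (simp add: z'x)
    show "torus_proj (y' + - (1 * t) *\<^sub>R ?b) \<notin> arr_vertices H" if "0 < t" "t \<le> s / 2" for t
    proof -
      have "y' + - (1 * t) *\<^sub>R ?b = x' + (s - t) *\<^sub>R ?b"
        by (simp add: y'_def algebra_simps)
      then show ?thesis using free[of "s - t"] that proj_x' by simp
    qed
  qed (use side SK sep[OF W'(1) y'W] s in auto)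
  then obtain w c where w: "w \<in> closure P" "c > 0" "w = y' + c *\<^sub>R lattice_vec (dir W')" by auto
  have side': "\<exists>L\<in>H. \<exists>c>0. v = u + (- 1 * c) *\<^sub>R lattice_vec (dir L) \<and>
      (\<forall>w\<in>closed_segment u v. torus_proj w \<in> points L) \<and>
      (\<forall>w\<in>open_segment u v. torus_proj w \<notin> arr_vertices H)" if "(u, v) \<in> S\<inverse>" for u v
  proof -
    have "(v, u) \<in> S" using that by simp
    then obtain L c where L: "L \<in> H" "c > 0" "u = v + c *\<^sub>R lattice_vec (dir L)"
      "\<forall>w\<in>closed_segment v u. torus_proj w \<in> points L"
      "\<forall>w\<in>open_segment v u. torus_proj w \<notin> arr_vertices H"
      using side by blast
    from L(3) have "v = u + (- 1 * c) *\<^sub>R lattice_vec (dir L)" by simp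
    with L(1,2,4,5) show ?thesis
      unfolding closed_segment_commute[of v u] open_segment_commute[of v u] by blast
  qed
  have uv0': "(v0, u0) \<in> S\<inverse>" using uv0(1) by simp
  have "\<exists>w\<in>closure P. \<exists>c>0. w = x' + (- 1 * c) *\<^sub>R lattice_vec (dir W)"
  proof (rule boundary_turns[where r = "s / 2", OF lines simple _ _ _ side' B W _ x'B x'W uv0'])
    show "cross (dir W) (dir B) \<noteq> 0" using cr by (simp add: cross_def algebra_simps)
    show "x' + - (- 1 * (s / 2)) *\<^sub>R ?b \<in> closed_segment v0 u0"
      using uv0(2) by (simp add: z'x closed_segment_commute)
    show "torus_proj (x' + - (- 1 * t) *\<^sub>R ?b) \<notin> arr_vertices H" if "0 < t" "t \<le> s / 2" for t
      using free[of t] that proj_x' by simp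
  qed (use uv0 prv SK sep[OF W(1) x'W] s \<open>finite S\<close> in auto)
  then obtain w' c' where w': "w' \<in> closure P" "c' > 0" "w' = x' + (- c') *\<^sub>R lattice_vec (dir W)" by auto
  have lw: "level (dir B) w = level (dir B) x' + c * of_int (cross (dir B) (dir W'))"
    by (simp add: w(3) y'_def)
  have lw': "level (dir B) w' = level (dir B) x' - c' * of_int (cross (dir B) (dir W))"
    unfolding w'(3) level_add_lattice by simp
  show ?thesis
  proof (rule ccontr)
    assume "\<not> ?thesis"
    then consider "cross (dir B) (dir W) > 0" "cross (dir B) (dir W') > 0"
      | "cross (dir B) (dir W) < 0" "cross (dir B) (dir W') < 0"
      using cr cr' by (metis linorder_neqE_linordered_idom mult_neg_pos mult_pos_neg)
    then show False
    proof cases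
      case 1
      then have "c * of_int (cross (dir B) (dir W')) > 0" "c' * of_int (cross (dir B) (dir W)) > 0"
        using w(2) w'(2) by simp_all
      then show False using sep[OF B x'B w'(1) w(1)] lw lw' by linarith
    next
      case 2
      then have "c * of_int (cross (dir B) (dir W')) < 0" "c' * of_int (cross (dir B) (dir W)) < 0"
        using w(2) w'(2) by (simp_all add: mult_less_0_iff)
      then show False using sep[OF B x'B w(1) w'(1)] lw lw' by linarith
    qed
  qed
qed


section \<open>The five directions\<close>

lemma lattice_vec_eq_iff: "lattice_vec u = lattice_vec v \<longleftrightarrow> u = v"
  by (cases u; cases v) (simp add: lattice_vec_def)

text \<open>Strict separation makes \<open>v\<close> indispensable: without it the hull of
  \<open>V\<close> would stay in an open half-plane that excludes \<open>v\<close>.\<close>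

lemma vertex_if_separated:
  fixes a b :: int
  assumes hull: "convex hull (lattice_vec ` V) = convex hull (lattice_vec ` S)" and "V \<subseteq> S" and "v \<in> S"
    and sep: "\<And>u. u \<in> S \<Longrightarrow> u \<noteq> v \<Longrightarrow> a * fst u + b * snd u > a * fst v + b * snd v"
  shows "v \<in> V"
proof (rule ccontr)
  assume "v \<notin> V"
  let ?h = "{w. inner (of_int a, of_int b) w > (of_int (a * fst v + b * snd v) :: real)}"
  have "lattice_vec u \<in> ?h" if "u \<in> V" for u
  proof -
    have "a * fst u + b * snd u > a * fst v + b * snd v" using sep that \<open>V \<subseteq> S\<close> \<open>v \<notin> V\<close> by blast
    then have "real_of_int (a * fst u + b * snd u) > of_int (a * fst v + b * snd v)" by (simp only: of_int_less_iff)
    then show ?thesis by (simp add: lattice_vec_def inner_prod_def)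
  qed
  then have "convex hull (lattice_vec ` V) \<subseteq> ?h"
    by (intro hull_minimal convex_halfspace_gt) auto
  moreover have "lattice_vec v \<in> convex hull (lattice_vec ` V)"
    unfolding hull using \<open>v \<in> S\<close> by (simp add: hull_inc)
  ultimately show False by (auto simp: lattice_vec_def inner_prod_def)
qed

context
  fixes k :: int and S :: "(int \<times> int) set"
  assumes k: "k \<ge> 3"
  defines "S \<equiv> {(0, 0), (1, 0), (0, 1), (k + 1, 1), (1, 2)}"
begin

lemma set_ccw_vertices:
  assumes "ccw_vertices (convex hull (lattice_vec ` S)) vs"
  shows "set vs = S"
proof
  have hull: "convex hull (lattice_vec ` set vs) = convex hull (lattice_vec ` S)"
    and ext: "{v. v extreme_point_of (convex hull (lattice_vec ` S))} = lattice_vec ` set vs"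
    using assms unfolding ccw_vertices_def by auto
  have "lattice_vec ` set vs \<subseteq> lattice_vec ` S"
    using extreme_point_of_convex_hull ext by blast
  then show sub: "set vs \<subseteq> S" by (auto simp: lattice_vec_eq_iff)
  note sep = vertex_if_separated[OF hull sub]
  \<comment> \<open>In each of these lines the two given numbers are the coefficients of a linear
    functional whose strict minimum on \<open>S\<close> is at the point in question.\<close>
  have "(0, 0) \<in> set vs" by (rule sep[of _ 1 1]) (use k in \<open>auto simp: S_def\<close>)
  moreover have "(1, 0) \<in> set vs" by (rule sep[of _ "- 1" "k + 1"]) (use k in \<open>auto simp: S_def\<close>)
  moreover have "(0, 1) \<in> set vs" by (rule sep[of _ 2 "- 1"]) (use k in \<open>auto simp: S_def\<close>)
  moreover have "(k + 1, 1) \<in> set vs" by (rule sep[of _ "- 1" 0]) (use k in \<open>auto simp: S_def\<close>)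
  moreover have "(1, 2) \<in> set vs" by (rule sep[of _ 0 "- 1"]) (use k in \<open>auto simp: S_def\<close>)
  ultimately show "S \<subseteq> set vs" by (simp add: S_def)
qed

lemma ccw_successor:
  assumes "v \<in> S" "w \<in> S" "v \<noteq> w"
    and "\<And>u. u \<in> S \<Longrightarrow> u \<noteq> v \<Longrightarrow> u \<noteq> w \<Longrightarrow> 0 < cross (w - v) (u - v)"
  shows "(v, w) \<in> {((0, 0), (1, 0)), ((1, 0), (k + 1, 1)), ((k + 1, 1), (1, 2)), ((1, 2), (0, 1)), ((0, 1), (0, 0))}"
proof -
  \<comment> \<open>The test point is the true successor of \<open>v\<close>: for every other choice
    of \<open>w\<close> it fails to lie strictly to the left of the ray from \<open>v\<close> to
    \<open>w\<close>.\<close>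
  have "w = (1, 0)" if "v = (0, 0)"
    using assms(2,3) assms(4)[of "(1, 0)"] k unfolding that by (auto simp: S_def cross_def)
  moreover have "w = (k + 1, 1)" if "v = (1, 0)"
    using assms(2,3) assms(4)[of "(k + 1, 1)"] k unfolding that by (auto simp: S_def cross_def)
  moreover have "w = (1, 2)" if "v = (k + 1, 1)"
    using assms(2,3) assms(4)[of "(1, 2)"] k unfolding that by (auto simp: S_def cross_def)
  moreover have "w = (0, 1)" if "v = (1, 2)"
    using assms(2,3) assms(4)[of "(0, 1)"] k unfolding that by (auto simp: S_def cross_def)
  moreover have "w = (0, 0)" if "v = (0, 1)"
    using assms(2,3) assms(4)[of "(0, 0)"] k unfolding that by (auto simp: S_def cross_def)
  moreover have "v = (0, 0) \<or> v = (1, 0) \<or> v = (k + 1, 1) \<or> v = (1, 2) \<or> v = (0, 1)"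
    using assms(1) by (auto simp: S_def)
  ultimately show ?thesis by (elim disjE) simp_all
qed

lemma facet_directions:
  assumes ccw: "ccw_vertices (convex hull (lattice_vec ` S)) vs"
  shows "(\<lambda>j. rot_cw (facet vs j)) ` {..<length vs} = {(0, - 1), (1, - k), (1, k), (- 1, 1), (- 1, 0)}"
proof -
  have set: "set vs = S" by (rule set_ccw_vertices[OF ccw])
  have dist: "distinct vs" and len: "3 \<le> length vs" using ccw by (auto simp: ccw_vertices_def)
  let ?R = "{((0, 0), (1, 0)), ((1, 0), (k + 1, 1)), ((k + 1, 1), (1, 2)), ((1, 2), (0, 1)), ((0, 1), (0, 0))}"
  have succ: "(vs ! j, vs ! (Suc j mod length vs)) \<in> ?R" if j: "j < length vs" for j
  proof (rule ccw_successor)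
    have j': "Suc j mod length vs < length vs" using j by (intro mod_less_divisor) linarith
    have "Suc j mod length vs \<noteq> j" using j len by (cases "Suc j = length vs") auto
    with j j' show "vs ! j \<noteq> vs ! (Suc j mod length vs)" using dist by (metis nth_eq_iff_index_eq)
    show "vs ! j \<in> S" "vs ! (Suc j mod length vs) \<in> S" using j j' set nth_mem by auto
    fix u assume u: "u \<in> S" "u \<noteq> vs ! j" "u \<noteq> vs ! (Suc j mod length vs)"
    then obtain i where "i < length vs" "u = vs ! i" using set by (metis in_set_conv_nth)
    with u j show "0 < cross (vs ! (Suc j mod length vs) - vs ! j) (u - vs ! j)"
      using ccw unfolding ccw_vertices_def facet_def by blast
  qed
  \<comment> \<open>The rotated side leaving a vertex, as a function of the vertex instead of its
    index, does not see where the list \<open>vs\<close> begins.\<close>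
  define g :: "int \<times> int \<Rightarrow> int \<times> int" where "g v = (if v = (0, 0) then (0, - 1) else if v = (1, 0) then (1, - k)
    else if v = (k + 1, 1) then (1, k) else if v = (1, 2) then (- 1, 1) else (- 1, 0))" for v
  have "rot_cw (facet vs j) = g (vs ! j)" if "j < length vs" for j
    using succ[OF that] k by (auto simp: facet_def rot_cw_def g_def)
  then have "(\<lambda>j. rot_cw (facet vs j)) ` {..<length vs} = (\<lambda>j. g (vs ! j)) ` {..<length vs}" by auto
  also have "\<dots> = g ` S"
    unfolding set[symmetric] by (auto simp: set_conv_nth)
  also have "\<dots> = {g (0, 0), g (1, 0), g (k + 1, 1), g (1, 2), g (0, 1)}"
    by (auto simp: S_def)
  also have "\<dots> = {(0, - 1), (1, - k), (1, k), (- 1, 1), (- 1, 0)}"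
    using k by (simp add: g_def)
  finally show ?thesis .
qed

end


text \<open>The lines of a class share one vector \<open>d\<close>, so the class sums to its
  cardinality times \<open>d\<close>. A primitive sum forces the cardinality to be 1, and
  \<open>d\<close> is then the prescribed vector itself.\<close>

lemma dual_arrangement_primitive:
  assumes dual: "dual_arrangement N H" and G: "\<And>vs. ccw_vertices N vs \<Longrightarrow> (\<lambda>j. rot_cw (facet vs j)) ` {..<length vs} = G"
    and prim: "\<And>g. g \<in> G \<Longrightarrow> coprime (fst g) (snd g)"
  shows "inj_on dir H" "dir ` H = G"
proof -
  obtain vs \<beta> where vs: "ccw_vertices N vs" and \<beta>: "bij_betw \<beta> {..<length vs} (line_classes H)"
    and sum: "\<And>j. j < length vs \<Longrightarrow> (\<Sum>L\<in>\<beta> j. dir L) = rot_cw (facet vs j)"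
    and fin: "finite H"
    using dual unfolding dual_arrangement_def arrangement_def by blast
  have block: "card {L \<in> H. dir L = d} = 1 \<and> rot_cw (facet vs j) = d"
    if j: "j < length vs" "\<beta> j = {L \<in> H. dir L = d}" "d \<in> dir ` H" for j d
  proof -
    let ?C = "{L \<in> H. dir L = d}"
    let ?g = "rot_cw (facet vs j)"
    have g: "?g = (\<Sum>L\<in>?C. d)" using sum[OF j(1)] by (simp add: j(2))
    have f: "fst ?g = int (card ?C) * fst d" "snd ?g = int (card ?C) * snd d"
      unfolding g by (simp_all add: fst_sum snd_sum)
    have "coprime (fst ?g) (snd ?g)" using prim G[OF vs] j(1) by blast
    then have "is_unit (int (card ?C))" unfolding f using coprime_common_divisor dvd_triv_left by blast
    then have "card ?C = 1" by simp
    with f show ?thesis by (simp add: prod_eq_iff)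
  qed
  have class_of: "\<exists>j<length vs. \<beta> j = {L \<in> H. dir L = d}" if "d \<in> dir ` H" for d
  proof -
    have "{L \<in> H. dir L = d} \<in> \<beta> ` {..<length vs}"
      using \<beta> that unfolding bij_betw_def line_classes_def by blast
    then show ?thesis by auto
  qed
  show "inj_on dir H"
  proof (rule inj_onI)
    fix L L' assume LL': "L \<in> H" "L' \<in> H" "dir L = dir L'"
    then have "card {M \<in> H. dir M = dir L} = 1" using block class_of by blast
    then obtain M where "{M \<in> H. dir M = dir L} = {M}" using card_1_singletonE by blast
    then show "L = L'" using LL' by (metis (mono_tags, lifting) mem_Collect_eq singletonD)
  qed
  show "dir ` H = G"
  proof
    show "dir ` H \<subseteq> G"
    proof
      fix d assume d: "d \<in> dir ` H"
      then obtain j where "j < length vs" "\<beta> j = {L \<in> H. dir L = d}" using class_of by blast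
      then have "j < length vs" "rot_cw (facet vs j) = d" using block d by simp_all
      then have "d \<in> (\<lambda>j. rot_cw (facet vs j)) ` {..<length vs}" by auto
      then show "d \<in> G" by (simp only: G[OF vs])
    qed
    show "G \<subseteq> dir ` H"
    proof
      fix g assume "g \<in> G"
      then obtain j where j: "j < length vs" "g = rot_cw (facet vs j)" using G[OF vs] by blast
      then have "\<beta> j \<in> line_classes H" using \<beta> by (auto simp: bij_betw_def)
      then obtain d where d: "d \<in> dir ` H" "\<beta> j = {L \<in> H. dir L = d}" by (auto simp: line_classes_def)
      then have "rot_cw (facet vs j) = d" using block[OF j(1)] by simp
      with d j(2) show "g \<in> dir ` H" by (simp only:)
    qed
  qed
qed

section \<open>Crossings along the line of direction \<open>(1, -k)\<close>\<close>

text \<open>Along the path the level of \<open>L\<close> changes at the constant rate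
  \<open>cross (dir L) b\<close>, while the lifts of \<open>L\<close> sit at levels
  \<open>2 * pi\<close> apart.\<close>

lemma crossing_times:
  assumes "is_oriented_line L" and "cross (dir L) b \<noteq> 0"
  shows "\<exists>t0. \<forall>t. torus_proj (p + t *\<^sub>R lattice_vec b) \<in> points L \<longleftrightarrow>
    (\<exists>n::int. t = t0 + 2 * pi * of_int n / of_int \<bar>cross (dir L) b\<bar>)"
proof -
  obtain c where c: "\<And>u. torus_proj u \<in> points L \<longleftrightarrow> (\<exists>n::int. level (dir L) u = c + 2 * pi * of_int n)"
    using line_levels[OF assms(1)] by blast
  define m where "m = real_of_int (cross (dir L) b)"
  have m: "m \<noteq> 0" using assms(2) by (simp add: m_def)
  define t0 where "t0 = (c - level (dir L) p) / m"
  have "torus_proj (p + t *\<^sub>R lattice_vec b) \<in> points L \<longleftrightarrow> (\<exists>n::int. t = t0 + 2 * pi * of_int n / \<bar>m\<bar>)" for t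
  proof -
    have 1: "torus_proj (p + t *\<^sub>R lattice_vec b) \<in> points L \<longleftrightarrow> (\<exists>n::int. t = t0 + 2 * pi * of_int n / m)"
    proof -
      have "level (dir L) p + t * m = c + 2 * pi * of_int n \<longleftrightarrow> t = t0 + 2 * pi * of_int n / m" for n :: int
      proof -
        have eq: "t0 + 2 * pi * of_int n / m = (c - level (dir L) p + 2 * pi * of_int n) / m"
          by (simp add: t0_def add_divide_distrib)
        show ?thesis unfolding eq using m by (auto simp: nonzero_eq_divide_eq)
      qed
      then show ?thesis unfolding c level_add_lattice m_def[symmetric] by simp
    qed
    \<comment> \<open>A negative rate only reverses the numbering by \<open>n\<close>.\<close>
    also have "\<dots> \<longleftrightarrow> (\<exists>n::int. t = t0 + 2 * pi * of_int n / \<bar>m\<bar>)"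
    proof (cases "m > 0")
      case False
      then have "\<bar>m\<bar> = - m" by simp
      then have neg: "2 * pi * of_int n / m = 2 * pi * of_int (- n) / \<bar>m\<bar>" for n :: int by simp
      show ?thesis
      proof
        assume "\<exists>n::int. t = t0 + 2 * pi * of_int n / m"
        then show "\<exists>n::int. t = t0 + 2 * pi * of_int n / \<bar>m\<bar>" unfolding neg by blast
      next
        assume "\<exists>n::int. t = t0 + 2 * pi * of_int n / \<bar>m\<bar>"
        then obtain n :: int where "t = t0 + 2 * pi * of_int n / \<bar>m\<bar>" by blast
        then have "t = t0 + 2 * pi * of_int (- n) / m" by (simp only: neg minus_minus)
        then show "\<exists>n::int. t = t0 + 2 * pi * of_int n / m" by blast
      qed
    qed simp
    finally show ?thesis .
  qed
  then show ?thesis unfolding m_def by auto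
qed

text \<open>Finiteness is what makes "the next crossing" meaningful, as a minimum over a bounded
  stretch.\<close>

lemma finite_crossing_times:
  assumes "is_oriented_line L" and "cross (dir L) b \<noteq> 0"
  shows "finite {t \<in> {u..v}. torus_proj (p + t *\<^sub>R lattice_vec b) \<in> points L}"
proof -
  obtain t0 where t0: "\<And>t. torus_proj (p + t *\<^sub>R lattice_vec b) \<in> points L \<longleftrightarrow>
    (\<exists>n::int. t = t0 + 2 * pi * of_int n / of_int \<bar>cross (dir L) b\<bar>)"
    using crossing_times[OF assms] by blast
  define m where "m = real_of_int \<bar>cross (dir L) b\<bar> / (2 * pi)"
  have m: "m > 0" using assms(2) by (simp add: m_def)
  have "{t \<in> {u..v}. torus_proj (p + t *\<^sub>R lattice_vec b) \<in> points L} \<subseteq>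
    (\<lambda>n::int. t0 + of_int n / m) ` {n. (u - t0) * m \<le> of_int n \<and> of_int n \<le> (v - t0) * m}"
  proof
    fix t assume "t \<in> {t \<in> {u..v}. torus_proj (p + t *\<^sub>R lattice_vec b) \<in> points L}"
    then have t: "u \<le> t" "t \<le> v" "torus_proj (p + t *\<^sub>R lattice_vec b) \<in> points L" by simp_all
    obtain n :: int where "t = t0 + 2 * pi * of_int n / of_int \<bar>cross (dir L) b\<bar>"
      using t(3) unfolding t0 by blast
    then have n: "t = t0 + of_int n / m" by (simp add: m_def mult.commute)
    have "of_int n = (t - t0) * m" using m by (simp add: n)
    then have "(u - t0) * m \<le> of_int n" "of_int n \<le> (v - t0) * m"
      using m t(1,2) by (simp_all add: mult_right_mono)
    with n show "t \<in> (\<lambda>n::int. t0 + of_int n / m) ` {n. (u - t0) * m \<le> of_int n \<and> of_int n \<le> (v - t0) * m}"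
      by blast
  qed
  moreover have "{n::int. (u - t0) * m \<le> of_int n \<and> of_int n \<le> (v - t0) * m} \<subseteq> {\<lceil>(u - t0) * m\<rceil>..\<lfloor>(v - t0) * m\<rfloor>}"
    by (auto simp: ceiling_le_iff le_floor_iff)
  then have "finite {n::int. (u - t0) * m \<le> of_int n \<and> of_int n \<le> (v - t0) * m}"
    by (rule finite_subset) simp
  ultimately show ?thesis by (meson finite_imageI finite_subset)
qed

text \<open>Alternation is applied to \<open>D\<close> and the first vertex on \<open>B\<close>
  after \<open>tD\<close>, whatever line passes there. This vertex comes no later than
  \<open>tE\<close>, which is a vertex itself.\<close>

lemma crossing_between:
  assumes arr: "arrangement H" and simple: "simple_arrangement H" and adm: "admissible H"
    and B: "B \<in> H" and transv: "\<And>L. L \<in> H \<Longrightarrow> L \<noteq> B \<Longrightarrow> cross (dir B) (dir L) \<noteq> 0"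
    and D: "D \<in> H" "D \<noteq> B" "cross (dir B) (dir D) < 0" and E: "E \<in> H" "E \<noteq> B" "cross (dir B) (dir E) < 0"
    and pB: "torus_proj p \<in> points B"
    and tD: "torus_proj (p + tD *\<^sub>R lattice_vec (dir B)) \<in> points D"
    and tE: "torus_proj (p + tE *\<^sub>R lattice_vec (dir B)) \<in> points E" and less: "tD < tE"
  shows "\<exists>C\<in>H. cross (dir B) (dir C) > 0 \<and>
    (\<exists>t. tD < t \<and> t \<le> tE \<and> torus_proj (p + t *\<^sub>R lattice_vec (dir B)) \<in> points C)"
proof -
  let ?b = "lattice_vec (dir B)"
  have lines: "is_oriented_line L" if "L \<in> H" for L using arr that by (simp add: arrangement_def)
  have on_B: "torus_proj (p + t *\<^sub>R ?b) \<in> points B" for t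
    using same_level_in_line[OF lines[OF B] pB] by simp
  define T where "T = {t. tD < t \<and> t \<le> tE \<and> torus_proj (p + t *\<^sub>R ?b) \<in> arr_vertices H}"
  have "T \<subseteq> (\<Union>L\<in>H - {B}. {t \<in> {tD..tE}. torus_proj (p + t *\<^sub>R ?b) \<in> points L})"
  proof
    fix t assume "t \<in> T"
    then have t: "tD < t" "t \<le> tE" "torus_proj (p + t *\<^sub>R ?b) \<in> arr_vertices H" by (simp_all add: T_def)
    then obtain L where "L \<in> H" "L \<noteq> B" "torus_proj (p + t *\<^sub>R ?b) \<in> points L"
      unfolding arr_vertices_def by blast
    with t show "t \<in> (\<Union>L\<in>H - {B}. {t \<in> {tD..tE}. torus_proj (p + t *\<^sub>R ?b) \<in> points L})" by auto
  qed
  moreover have "finite \<dots>"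
  proof (intro finite_UN_I finite_crossing_times)
    show "finite (H - {B})" using arr by (simp add: arrangement_def)
    fix L assume L: "L \<in> H - {B}"
    then show "is_oriented_line L" using lines by simp
    show "cross (dir L) (dir B) \<noteq> 0" using transv[of L] cross_commute[of "dir L"] L by simp
  qed
  ultimately have "finite T" by (rule finite_subset)
  have "tE \<in> T" using less tE E B on_B by (auto simp: T_def arr_vertices_def)
  define t where "t = Min T"
  have "t \<in> T" using \<open>finite T\<close> \<open>tE \<in> T\<close> Min_in by (auto simp: t_def)
  then obtain W where W: "W \<in> H" "W \<noteq> B" "torus_proj (p + t *\<^sub>R ?b) \<in> points W"
    unfolding T_def arr_vertices_def by blast
  have "cross (dir B) (dir D) * cross (dir B) (dir W) < 0"
  proof (rule crossings_alternate[OF arr simple adm B D(1,2) W(1,2) _ _ on_B tD, of "t - tD"])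
    have shift: "p + tD *\<^sub>R ?b + r *\<^sub>R ?b = p + (tD + r) *\<^sub>R ?b" for r by (simp add: algebra_simps)
    show "torus_proj (p + tD *\<^sub>R ?b + (t - tD) *\<^sub>R ?b) \<in> points W"
      unfolding shift using W by simp
    show "torus_proj (p + tD *\<^sub>R ?b + r *\<^sub>R ?b) \<notin> arr_vertices H" if "0 < r" "r < t - tD" for r
    proof
      assume "torus_proj (p + tD *\<^sub>R ?b + r *\<^sub>R ?b) \<in> arr_vertices H"
      then have "tD + r \<in> T" using that \<open>t \<in> T\<close> unfolding shift by (auto simp: T_def)
      then have "t \<le> tD + r" using \<open>finite T\<close> by (simp add: t_def)
      then show False using that by simp
    qed
  qed (use D W transv \<open>t \<in> T\<close> in \<open>auto simp: T_def\<close>)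
  then have "cross (dir B) (dir W) > 0" using D(3) by (simp add: mult_less_0_iff)
  then show ?thesis using W \<open>t \<in> T\<close> unfolding T_def by blast
qed

text \<open>Moving on by \<open>j\<close> spacings from both \<open>d\<close> and \<open>e\<close> changes \<open>d - e\<close> by \<open>2 pi j / (k (k - 1))\<close>,
  a multiple of a step not exceeding the gap length \<open>pi / k\<close>.\<close>

lemma common_gap:
  fixes k :: int and c d e :: real
  assumes "k \<ge> 3"
  shows "\<exists>m j :: int. c + of_int m * (pi / of_int k) \<le> e + 2 * pi * of_int j / of_int k \<and>
    e + 2 * pi * of_int j / of_int k < c + of_int (m + 1) * (pi / of_int k) \<and>
    c + of_int m * (pi / of_int k) < d + 2 * pi * of_int j / of_int (k - 1) \<and>
    d + 2 * pi * of_int j / of_int (k - 1) \<le> c + of_int (m + 1) * (pi / of_int k)"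
proof -
  define K where "K = real_of_int k"
  have K: "K \<ge> 3" using assms by (simp add: K_def)
  define h where "h = pi / K"
  \<comment> \<open>The difference of the two spacings \<open>2 * pi / (K - 1)\<close> and
    \<open>2 * pi / K\<close>.\<close>
  define g where "g = 2 * pi / (K * (K - 1))"
  have "h > 0" "g > 0" using K by (simp_all add: h_def g_def)
  have "g = h * (2 / (K - 1))" by (simp add: g_def h_def)
  also have "\<dots> \<le> h * 1" using K \<open>h > 0\<close> by (intro mult_left_mono) simp_all
  finally have "g \<le> h" by simp
  \<comment> \<open>\<open>i\<close> numbers the gap that contains \<open>e\<close>. A step of
    \<open>2 * pi / k\<close> is two gaps long, so after \<open>j\<close> steps the gap is number
    \<open>i + 2 * j\<close>, and relative to it only \<open>d\<close> has moved, by
    \<open>j * g\<close>. The largest \<open>j\<close> for which \<open>d\<close> does not exceed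
    the right end leaves it less than \<open>g \<le> h\<close> short of that end, hence
    inside.\<close>
  define i where "i = \<lfloor>(e - c) / h\<rfloor>"
  define j where "j = \<lfloor>(c + of_int i * h + h - d) / g\<rfloor>"
  have i: "of_int i * h \<le> e - c" "e - c < (of_int i + 1) * h"
    unfolding i_def by (rule floor_divide_lower floor_divide_upper, fact)+
  have j: "of_int j * g \<le> c + of_int i * h + h - d" "c + of_int i * h + h - d < (of_int j + 1) * g"
    unfolding j_def by (rule floor_divide_lower floor_divide_upper, fact)+
  have e_eq: "e + 2 * pi * of_int j / of_int k = e + 2 * of_int j * h"
    by (simp add: h_def K_def)
  have "1 / (K - 1) = 1 / (K * (K - 1)) + 1 / K"
    using K by (simp add: divide_simps)
  then have "2 * pi * of_int j * (1 / (K - 1)) = 2 * pi * of_int j * (1 / (K * (K - 1)) + 1 / K)"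
    by (simp only:)
  then have d_eq: "d + 2 * pi * of_int j / of_int (k - 1) = d + of_int j * g + 2 * of_int j * h"
    by (simp add: g_def h_def K_def distrib_left mult.commute)
  show ?thesis
    by (rule exI[of _ "i + 2 * j"], rule exI[of _ j], unfold e_eq d_eq, fold K_def, fold h_def) (use i j \<open>g \<le> h\<close> in \<open>simp add: algebra_simps\<close>)
qed

theorem mainTheorem4:
  fixes k :: int and N :: "(real \<times> real) set"
  assumes "k \<ge> 5"
    and "N = convex hull (lattice_vec ` {(0, 0), (1, 0), (0, 1), (k + 1, 1), (1, 2)})"
  shows "\<not> (\<exists>H. dual_arrangement N H \<and> simple_arrangement H \<and> admissible H)"
proof
  assume "\<exists>H. dual_arrangement N H \<and> simple_arrangement H \<and> admissible H"
  then obtain H where dual: "dual_arrangement N H" and simple: "simple_arrangement H" and adm: "admissible H"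
    by blast
  have arr: "arrangement H" using dual by (simp add: dual_arrangement_def)
  then have lines: "is_oriented_line L" if "L \<in> H" for L using that by (simp add: arrangement_def)
  let ?G = "{(0, - 1), (1, - k), (1, k), (- 1, 1), (- 1, 0)}"
  have facets: "(\<lambda>j. rot_cw (facet vs j)) ` {..<length vs} = ?G" if "ccw_vertices N vs" for vs
    using facet_directions[of k vs] that assms by simp
  have prim: "coprime (fst g) (snd g)" if "g \<in> ?G" for g using that by auto
  have inj: "inj_on dir H" and dirs: "dir ` H = ?G"
    using dual_arrangement_primitive[OF dual facets prim] by blast+
  obtain B where B: "B \<in> H" "dir B = (1, - k)" using dirs by (metis (no_types, lifting) imageE insert_iff)
  obtain C where C: "C \<in> H" "dir C = (1, k)" using dirs by (metis (no_types, lifting) imageE insert_iff)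
  obtain D where D: "D \<in> H" "dir D = (- 1, 1)" using dirs by (metis (no_types, lifting) imageE insert_iff)
  obtain E where E: "E \<in> H" "dir E = (- 1, 0)" using dirs by (metis (no_types, lifting) imageE insert_iff)
  have neq: "B \<noteq> C" "B \<noteq> D" "B \<noteq> E" "C \<noteq> D" "C \<noteq> E" "D \<noteq> E" using B C D E assms(1) by auto
  \<comment> \<open>\<open>cross (dir B)\<close> takes the values \<open>- 1\<close>,
    \<open>1 - k\<close> and \<open>- k\<close> on \<open>(0, - 1)\<close>, \<open>(- 1, 1)\<close>
    and \<open>(- 1, 0)\<close>, against \<open>2 * k\<close> on \<open>dir C\<close>.\<close>
  have signs: "L = C \<or> cross (dir B) (dir L) < 0" if "L \<in> H" "L \<noteq> B" for L
  proof -
    have "dir L \<in> dir ` H" using that(1) by (rule imageI)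
    then have "dir L \<in> ?G" unfolding dirs .
    moreover have "dir L \<noteq> dir B" using inj_on_eq_iff[OF inj that(1) B(1)] that(2) by simp
    ultimately have "dir L = (0, - 1) \<or> dir L = dir C \<or> dir L = (- 1, 1) \<or> dir L = (- 1, 0)"
      unfolding B(2) C(2) by simp
    then show ?thesis
    proof (elim disjE)
      assume "dir L = dir C"
      then show ?thesis using inj_on_eq_iff[OF inj that(1) C(1)] by simp
    qed (use assms(1) in \<open>simp_all add: B(2) cross_def\<close>)
  qed
  have crC: "cross (dir B) (dir C) > 0" using B C assms(1) by (simp add: cross_def)
  define b where "b = lattice_vec (dir B)"
  obtain p where p: "torus_proj p \<in> points B"
    using lines[OF B(1)] by (force simp: is_oriented_line_def)
  define r where "r t = torus_proj (p + t *\<^sub>R b)" for t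
  have rB: "r t \<in> points B" for t
    using same_level_in_line[OF lines[OF B(1)] p] by (simp add: r_def b_def)
  have single: "False" if "r t \<in> points L" "r t \<in> points M" "L \<in> H" "M \<in> H" "L \<noteq> M" "B \<noteq> L" "B \<noteq> M" for t L M
    using simple B(1) that rB[of t] unfolding simple_arrangement_def by blast
  have abs_cross: "\<bar>cross (dir C) (dir B)\<bar> = 2 * k" "\<bar>cross (dir D) (dir B)\<bar> = k - 1" "\<bar>cross (dir E) (dir B)\<bar> = k"
    using assms(1) by (simp_all add: B C D E cross_def)
  have nz: "cross (dir C) (dir B) \<noteq> 0" "cross (dir D) (dir B) \<noteq> 0" "cross (dir E) (dir B) \<noteq> 0"
    using abs_cross assms(1) by auto
  obtain c0 where c0: "\<And>t. r t \<in> points C \<longleftrightarrow> (\<exists>n::int. t = c0 + 2 * pi * of_int n / of_int (2 * k))"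
    using crossing_times[OF lines[OF C(1)] nz(1), of p] unfolding abs_cross r_def b_def by blast
  obtain d0 where d0: "\<And>t. r t \<in> points D \<longleftrightarrow> (\<exists>n::int. t = d0 + 2 * pi * of_int n / of_int (k - 1))"
    using crossing_times[OF lines[OF D(1)] nz(2), of p] unfolding abs_cross r_def b_def by blast
  obtain e0 where e0: "\<And>t. r t \<in> points E \<longleftrightarrow> (\<exists>n::int. t = e0 + 2 * pi * of_int n / of_int k)"
    using crossing_times[OF lines[OF E(1)] nz(3), of p] unfolding abs_cross r_def b_def by blast
  define h where "h = pi / of_int k"
  have h: "h > 0" using assms(1) by (simp add: h_def)
  have C_iff: "r t \<in> points C \<longleftrightarrow> (\<exists>n::int. t = c0 + of_int n * h)" for t
    unfolding c0 h_def by (simp add: field_simps)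
  have "k \<ge> 3" using assms(1) by simp
  then obtain m j :: int where
    mj: "c0 + of_int m * h \<le> e0 + 2 * pi * of_int j / of_int k"
      "e0 + 2 * pi * of_int j / of_int k < c0 + of_int (m + 1) * h"
      "c0 + of_int m * h < d0 + 2 * pi * of_int j / of_int (k - 1)"
      "d0 + 2 * pi * of_int j / of_int (k - 1) \<le> c0 + of_int (m + 1) * h"
    unfolding h_def using common_gap[of k c0 e0 d0] by blast
  define lo hi where "lo = c0 + of_int m * h" and "hi = c0 + of_int (m + 1) * h"
  define tD where "tD = d0 + 2 * pi * of_int j / of_int (k - 1)"
  define tE where "tE = e0 + 2 * pi * of_int j / of_int k"
  note mj = mj[folded lo_def hi_def tD_def tE_def]
  have tE: "r tE \<in> points E" unfolding e0 tE_def by blast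
  have tD: "r tD \<in> points D" unfolding d0 tD_def by blast
  have "r lo \<in> points C" unfolding C_iff lo_def by blast
  have "r hi \<in> points C" unfolding C_iff hi_def by blast
  \<comment> \<open>The weak inequalities still allow a crossing at an end of the gap. There it
    would share a point with both \<open>B\<close> and \<open>C\<close>, which simplicity
    forbids.\<close>
  have "tE \<noteq> lo" using single[of tE C E] \<open>r lo \<in> points C\<close> tE C(1) E(1) neq by auto
  then have E_in: "lo < tE" "tE < hi" using mj by simp_all
  have "tD \<noteq> hi" using single[of tD C D] \<open>r hi \<in> points C\<close> tD C(1) D(1) neq by auto
  then have D_in: "lo < tD" "tD < hi" using mj by simp_all
  have "tD \<noteq> tE" using single[of tD D E] tD tE D(1) E(1) neq by auto
  have transv: "cross (dir B) (dir L) \<noteq> 0" if "L \<in> H" "L \<noteq> B" for L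
    using signs[OF that] crC by auto
  have negD: "cross (dir B) (dir D) < 0" using signs[of D] D(1) neq by simp
  have negE: "cross (dir B) (dir E) < 0" using signs[of E] E(1) neq by simp
  have between: "\<exists>C'\<in>H. cross (dir B) (dir C') > 0 \<and> (\<exists>t. u < t \<and> t \<le> v \<and> r t \<in> points C')"
    if U: "U \<in> H" "U \<noteq> B" "cross (dir B) (dir U) < 0" and V: "V \<in> H" "V \<noteq> B" "cross (dir B) (dir V) < 0"
      and uv: "r u \<in> points U" "r v \<in> points V" "u < v" for U V u v
    unfolding r_def b_def
  proof (rule crossing_between[OF arr simple adm B(1) _ U V p])
    show "torus_proj (p + u *\<^sub>R lattice_vec (dir B)) \<in> points U"
      "torus_proj (p + v *\<^sub>R lattice_vec (dir B)) \<in> points V"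
      using uv(1,2) unfolding r_def b_def .
  qed (fact transv uv(3))+
  \<comment> \<open>Either of \<open>tD\<close> and \<open>tE\<close> may come first; in both orders
    the positive crossing lies after the earlier and not beyond the later one, hence strictly inside
    the gap.\<close>
  have "\<exists>C'\<in>H. cross (dir B) (dir C') > 0 \<and> (\<exists>t. lo < t \<and> t < hi \<and> r t \<in> points C')"
  proof (cases "tD < tE")
    case True
    obtain C' t where "C' \<in> H" "cross (dir B) (dir C') > 0" "tD < t" "t \<le> tE" "r t \<in> points C'"
      using between[OF D(1) neq(2)[symmetric] negD E(1) neq(3)[symmetric] negE tD tE True] by blast
    moreover have "lo < t" "t < hi" using calculation D_in E_in by linarith+
    ultimately show ?thesis by blast
  next
    case False
    then have "tE < tD" using \<open>tD \<noteq> tE\<close> by simp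
    obtain C' t where "C' \<in> H" "cross (dir B) (dir C') > 0" "tE < t" "t \<le> tD" "r t \<in> points C'"
      using between[OF E(1) neq(3)[symmetric] negE D(1) neq(2)[symmetric] negD tE tD \<open>tE < tD\<close>] by blast
    moreover have "lo < t" "t < hi" using calculation D_in E_in by linarith+
    ultimately show ?thesis by blast
  qed
  then obtain C' t where C': "C' \<in> H" "cross (dir B) (dir C') > 0" "lo < t" "t < hi" "r t \<in> points C'"
    by blast
  have "C' \<noteq> B" using C'(2) by auto
  then have "C' = C" using signs[OF C'(1)] C'(2) by simp
  then obtain n :: int where "t = c0 + of_int n * h" using C'(5) C_iff by blast
  then have "of_int m * h < of_int n * h" "of_int n * h < of_int (m + 1) * h"
    using C'(3,4) by (simp_all only: lo_def hi_def add_less_cancel_left)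
  then have "m < n" "n < m + 1"
    using h by (simp_all only: mult_less_cancel_right_pos of_int_less_iff)
  then show False by simp
qed

end
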